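(* Let $l>0$ and, for each $d$, $h=ld^{-1/2}$. Let $\widetilde K$ range over the class $\mathcal{I}$ of product couplings of the RWM kernels $K(X_t,\cdot),K(Y_t,\cdot)$ targeting $\pi=\mathcal{N}_d(0,I_d)$ with step size $h$. Then for all $(x,y,v)\in\mathcal{S}$, $$\lim_{d\to\infty}\sup_{\widetilde K\in\mathcal{I}}\mathbb{E}\Big[h^2Z_x^\top Z_yB_xB_y\ \Big|\ \tfrac{\lVert X_t\rVert^2}{d}=x,\ \tfrac{\lVert Y_t\rVert^2}{d}=y,\ \tfrac{X_t^\top Y_t}{d}=v\Big]=l^2\,\mathbb{E}\Big[1\wedge e^{-lx^{1/2}Z-l^2/2}\wedge e^{-ly^{1/2}Z-l^2/2}\Big],$$ where $Z\sim\mathcal{N}(0,1)$, and the right-hand side is attained (as the $d\to\infty$ limit of the same conditional expectation) by the GCRN coupling.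
   Context: RWM updates: $X_{t+1}=X_t+hZ_xB_x$, $Y_{t+1}=Y_t+hZ_yB_y$, with $B_x=\mathbb{1}\{U_x\le\exp(-hX_t^\top Z_x-h^2\lVert Z_x\rVert^2/2)\}$, $B_y=\mathbb{1}\{U_y\le\exp(-hY_t^\top Z_y-h^2\lVert Z_y\rVert^2/2)\}$, marginally $Z_x,Z_y\sim\mathcal{N}_d(0,I_d)$ and $U_x,U_y\sim\mathrm{Unif}(0,1)$, $U_x$ independent of $Z_x$, $U_y$ independent of $Z_y$. A Markovian coupling couples $(U_x,Z_x)$ and $(U_y,Z_y)$ conditionally on $(X_t,Y_t)$. The class $\mathcal{I}$ of product couplings consists of all such couplings in which the pair $(U_x,U_y)$ is independent of the pair $(Z_x,Z_y)$. The GCRN coupling sets $U_y=U_x$ and $Z_x=Z-(n_x^\top Z)n_x+Z_1n_x$, $Z_y=Z-(n_y^\top Z)n_y+Z_1n_y$ with $n_x=-X_t/\lVert X_t\rVert$, $n_y=-Y_t/\lVert Y_t\rVert$, $Z\sim\mathcal{N}_d(0,I_d)$, $Z_1\sim\mathcal{N}(0,1)$ independent. $\mathcal{S}=\{(x,y,v):x,y\ge0,|v|\le\sqrt{xy}\}$. *)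

theory Defs
  imports "HOL-Probability.Probability"
begin

text \<open>Vectors in R^d are represented as functions nat => real, only indices i < d matter.\<close>

definition ip :: "nat \<Rightarrow> (nat \<Rightarrow> real) \<Rightarrow> (nat \<Rightarrow> real) \<Rightarrow> real" where
  "ip d a b = (\<Sum>i<d. a i * b i)"

definition N1 :: "real measure" where
  "N1 = density lborel std_normal_density"

definition Nd :: "nat \<Rightarrow> (nat \<Rightarrow> real) measure" where
  "Nd d = PiM {..<d} (\<lambda>_. N1)"

definition unif01 :: "real measure" where
  "unif01 = uniform_measure lborel {0..1}"

definition is_coupling :: "'a measure \<Rightarrow> ('a \<times> 'a) measure \<Rightarrow> bool" where
  "is_coupling M C \<longleftrightarrow> prob_space C \<and> sets C = sets (M \<Otimes>\<^sub>M M)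
      \<and> distr C M fst = M \<and> distr C M snd = M"

text \<open>Product couplings: the joint law of ((U_x,U_y),(Z_x,Z_y)) is CU \<Otimes> CZ, with CU a coupling
  of Unif(0,1) with itself and CZ a coupling of N_d with itself.\<close>

definition product_couplings ::
  "nat \<Rightarrow> ((real \<times> real) measure \<times> ((nat \<Rightarrow> real) \<times> (nat \<Rightarrow> real)) measure) set" where
  "product_couplings d = {(CU, CZ). is_coupling unif01 CU \<and> is_coupling (Nd d) CZ}"

text \<open>Acceptance indicator B for the RWM with target N_d(0,I_d), current state X, step h.\<close>

definition accept :: "nat \<Rightarrow> real \<Rightarrow> (nat \<Rightarrow> real) \<Rightarrow> (nat \<Rightarrow> real) \<Rightarrow> real \<Rightarrow> real" where
  "accept d h X z u = (if u \<le> exp (- h * ip d X z - h\<^sup>2 * ip d z z / 2) then 1 else 0)"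

definition rwm_cross ::
  "nat \<Rightarrow> real \<Rightarrow> (nat \<Rightarrow> real) \<Rightarrow> (nat \<Rightarrow> real) \<Rightarrow> (real \<times> real) measure
    \<Rightarrow> ((nat \<Rightarrow> real) \<times> (nat \<Rightarrow> real)) measure \<Rightarrow> real" where
  "rwm_cross d h X Y CU CZ =
     (\<integral>\<omega>. (case \<omega> of ((ux, uy), (zx, zy)) \<Rightarrow>
            h\<^sup>2 * ip d zx zy * accept d h X zx ux * accept d h Y zy uy) \<partial>(CU \<Otimes>\<^sub>M CZ))"

definition gcrn_dir :: "nat \<Rightarrow> (nat \<Rightarrow> real) \<Rightarrow> nat \<Rightarrow> real" where
  "gcrn_dir d X = (\<lambda>i. - X i / sqrt (ip d X X))"

definition gcrn_prop :: "nat \<Rightarrow> (nat \<Rightarrow> real) \<Rightarrow> (nat \<Rightarrow> real) \<Rightarrow> real \<Rightarrow> nat \<Rightarrow> real" where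
  "gcrn_prop d X z z1 = (\<lambda>i. if i < d then
       z i - ip d (gcrn_dir d X) z * gcrn_dir d X i + z1 * gcrn_dir d X i else undefined)"

definition gcrn_U :: "(real \<times> real) measure" where
  "gcrn_U = distr unif01 (unif01 \<Otimes>\<^sub>M unif01) (\<lambda>u. (u, u))"

definition gcrn_Z :: "nat \<Rightarrow> (nat \<Rightarrow> real) \<Rightarrow> (nat \<Rightarrow> real) \<Rightarrow> ((nat \<Rightarrow> real) \<times> (nat \<Rightarrow> real)) measure" where
  "gcrn_Z d X Y = distr (Nd d \<Otimes>\<^sub>M N1) (Nd d \<Otimes>\<^sub>M Nd d)
      (\<lambda>(z, z1). (gcrn_prop d X z z1, gcrn_prop d Y z z1))"

end

theory Submission
  imports Defs "HOL-Real_Asymp.Real_Asymp"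
begin

text \<open>Write $Q$ for the conditional probability, given the proposals, that both are accepted;
  independence of $(U_x, U_y)$ from the proposals gives $Q \le m$, the minimum of $1$ and the two
  acceptance ratios, with equality when $U_x = U_y$. Since
  $2 Z_x \cdot Z_y \le \|Z_x\|^2 + \|Z_y\|^2$ and $h^2 \|Z\|^2 \to l^2$ in $L^1$ at a rate that only
  depends on the marginal law, every coupling has value at most $l^2 E[m] + O(d^{-1/2})$, where in $m$
  only the one-dimensional projections of the proposals matter. The comonotone coupling of these
  projections maximises $E[m]$, and GCRN realises it while keeping $E\|Z_x - Z_y\|^2$ bounded.\<close>

text \<open>Under an arbitrary coupling the joint law of the two projections is unknown; only its
  marginals are fixed. A bound on the integrand therefore serves all couplings at once when it is a
  function of Z_x plus a function of Z_y. The rate comes from Var ||Z||^2 = 2d, which after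
  multiplication by h^2 = l^2/d leaves a mean deviation of at most l^2 sqrt(2/d). The projections
  need no limit, since h ||X|| = l sqrt x holds exactly in every dimension. Their normal law is
  itself read off from the GCRN proposal.\<close>

lemma prob_space_N1 [simp]: "prob_space N1"
  unfolding N1_def by (intro prob_space_normal_density) simp

lemma space_N1 [simp]: "space N1 = UNIV"
  by (simp add: N1_def)

lemma sets_N1 [simp, measurable_cong]: "sets N1 = sets borel"
  by (simp add: N1_def)

lemma prob_space_Nd [simp]: "prob_space (Nd d)"
  unfolding Nd_def by (intro prob_space_PiM) simp

lemma sets_Nd [simp, measurable_cong]: "sets (Nd d) = sets (PiM {..<d} (\<lambda>_. borel))"
  unfolding Nd_def by (intro sets_PiM_cong) simp_all

lemma prob_space_unif01 [simp]: "prob_space unif01"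
  unfolding unif01_def by (intro prob_space_uniform_measure) simp_all

lemma sets_unif01 [simp, measurable_cong]: "sets unif01 = sets borel"
  by (simp add: unif01_def)

lemma space_unif01 [simp]: "space unif01 = UNIV"
  by (simp add: unif01_def)

lemma space_Nd: "space (Nd d) = PiE {..<d} (\<lambda>_. UNIV)"
  by (simp add: Nd_def space_PiM)

lemma measurable_ip [measurable (raw)]:
  assumes "f \<in> measurable M (PiM {..<d} (\<lambda>_. borel))" "g \<in> measurable M (PiM {..<d} (\<lambda>_. borel))"
  shows "(\<lambda>w. ip d (f w) (g w)) \<in> borel_measurable M"
  unfolding ip_def
  by (intro borel_measurable_sum borel_measurable_times measurable_compose[OF assms(1)]
      measurable_compose[OF assms(2)] measurable_component_singleton) auto

lemma measurable_ip_const [measurable (raw)]: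
  assumes "g \<in> measurable M (PiM {..<d} (\<lambda>_. borel))"
  shows "(\<lambda>w. ip d X (g w)) \<in> borel_measurable M"
  unfolding ip_def
  by (intro borel_measurable_sum borel_measurable_times measurable_const
      measurable_compose[OF assms] measurable_component_singleton) auto

section \<open>Translations of Gaussian measures (Cameron-Martin)\<close>

text \<open>Completing the square: the law N(a,1) has density exp(a z - a^2/2) with respect to
  N(0,1).\<close>

lemma nn_integral_N1_shift:
  assumes [measurable]: "f \<in> borel_measurable borel"
  shows "(\<integral>\<^sup>+z. f (z + a) \<partial>N1) = (\<integral>\<^sup>+z. ennreal (exp (a * z - a\<^sup>2 / 2)) * f z \<partial>N1)"
proof -
  have eq: "std_normal_density (z - a) = std_normal_density z * exp (a * z - a\<^sup>2 / 2)" for z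
    unfolding std_normal_density_def mult.assoc exp_add[symmetric]
    by (simp add: power2_eq_square field_simps)
  have "(\<integral>\<^sup>+z. f (z + a) \<partial>N1) = (\<integral>\<^sup>+z. ennreal (std_normal_density z) * f (z + a) \<partial>lborel)"
    unfolding N1_def by (subst nn_integral_density) auto
  also have "\<dots> = (\<integral>\<^sup>+z. ennreal (std_normal_density (z - a)) * f z \<partial>lborel)"
    by (subst nn_integral_real_affine[where c = 1 and t = "- a"]) auto
  also have "\<dots> = (\<integral>\<^sup>+z. ennreal (exp (a * z - a\<^sup>2 / 2)) * f z \<partial>N1)"
    unfolding N1_def eq by (subst nn_integral_density) (auto simp: ennreal_mult' mult_ac)
  finally show ?thesis .
qed

text \<open>The translate of \<open>Nd d\<close> and the measure with the exponential density both
  agree on boxes with the product of the laws N(a_i,1), hence are equal. Restricting the translate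
  to \<open>{..<d}\<close> keeps it in the extensional function space that carries
  \<open>Nd d\<close>.\<close>

lemma nn_integral_Nd_shift:
  assumes [measurable]: "f \<in> borel_measurable (PiM {..<d} (\<lambda>_. borel))"
  shows "(\<integral>\<^sup>+z. f (\<lambda>i\<in>{..<d}. z i + a i) \<partial>Nd d)
       = (\<integral>\<^sup>+z. ennreal (exp (ip d a z - ip d a a / 2)) * f z \<partial>Nd d)"
proof -
  interpret product_sigma_finite "\<lambda>_::nat. N1"
    by (rule product_sigma_finite.intro) (simp add: prob_space_imp_sigma_finite)
  define e where "e = (\<lambda>c z::real. ennreal (exp (c * z - c\<^sup>2 / 2)))"
  have [measurable]: "e c \<in> borel_measurable borel" for c
    unfolding e_def by measurable
  define M where "M = (\<lambda>i. density N1 (e (a i)))"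
  have sets_M [simp, measurable_cong]: "sets (M i) = sets borel" for i
    by (simp add: M_def)
  have em: "emeasure (M i) A = emeasure N1 {z. z + a i \<in> A}" if [measurable]: "A \<in> sets borel" for i A
  proof -
    have "emeasure (M i) A = (\<integral>\<^sup>+z. e (a i) z * indicator A z \<partial>N1)"
      unfolding M_def by (subst emeasure_density) auto
    also have "\<dots> = (\<integral>\<^sup>+z. indicator A (z + a i) \<partial>N1)"
      by (subst nn_integral_N1_shift) (auto simp: e_def)
    also have "\<dots> = (\<integral>\<^sup>+z. indicator {z. z + a i \<in> A} z \<partial>N1)"
      by (intro nn_integral_cong) (auto simp: indicator_def)
    finally show ?thesis
      by simp
  qed
  have prob_M: "prob_space (M i)" for i
  proof
    show "emeasure (M i) (space (M i)) = 1"
      using em[of UNIV i] prob_space.emeasure_space_1[OF prob_space_N1] by (simp add: M_def)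
  qed
  interpret M: product_sigma_finite M
    by (rule product_sigma_finite.intro) (simp add: prob_M prob_space_imp_sigma_finite)
  have sets_PiM_M: "sets (PiM {..<d} M) = sets (PiM {..<d} (\<lambda>_. borel))"
    by (intro sets_PiM_cong) simp_all
  let ?T = "\<lambda>z. \<lambda>i\<in>{..<d}. z i + a i"
  have [measurable]: "?T \<in> measurable (Nd d) (PiM {..<d} (\<lambda>_. borel))"
    by measurable
  have 1: "distr (Nd d) (PiM {..<d} (\<lambda>_. borel)) ?T = PiM {..<d} M"
  proof (rule M.PiM_eqI)
    fix A assume A: "\<And>i. i \<in> {..<d} \<Longrightarrow> A i \<in> sets (M i)"
    then have [measurable]: "A i \<in> sets borel" if "i < d" for i
      using that by simp
    have "emeasure (distr (Nd d) (PiM {..<d} (\<lambda>_. borel)) ?T) (Pi\<^sub>E {..<d} A)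
        = emeasure (Nd d) (?T -` Pi\<^sub>E {..<d} A \<inter> space (Nd d))"
      by (intro emeasure_distr sets_PiM_I_finite) auto
    also have "?T -` Pi\<^sub>E {..<d} A \<inter> space (Nd d) = (\<Pi>\<^sub>E i\<in>{..<d}. {z. z + a i \<in> A i})"
      by (auto simp: space_Nd PiE_def Pi_def extensional_def restrict_def split: if_splits)
    also have "emeasure (Nd d) \<dots> = (\<Prod>i<d. emeasure N1 {z. z + a i \<in> A i})"
      unfolding Nd_def by (intro emeasure_PiM) auto
    also have "\<dots> = (\<Prod>i<d. emeasure (M i) (A i))"
      by (intro prod.cong refl em[symmetric]) auto
    finally show "emeasure (distr (Nd d) (PiM {..<d} (\<lambda>_. borel)) ?T) (Pi\<^sub>E {..<d} A) = \<dots>" .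
  qed (simp_all add: sets_PiM_M)
  let ?E = "\<lambda>z. ennreal (exp (ip d a z - ip d a a / 2))"
  have E_eq: "?E z = (\<Prod>i<d. e (a i) (z i))" for z
    by (simp add: e_def prod_ennreal exp_sum[symmetric] ip_def sum_subtractf sum_divide_distrib
        power2_eq_square)
  have 2: "density (Nd d) ?E = PiM {..<d} M"
  proof (rule M.PiM_eqI)
    fix A assume A: "\<And>i. i \<in> {..<d} \<Longrightarrow> A i \<in> sets (M i)"
    then have [measurable]: "A i \<in> sets borel" if "i < d" for i
      using that by simp
    have "emeasure (density (Nd d) ?E) (Pi\<^sub>E {..<d} A)
        = (\<integral>\<^sup>+z. ?E z * indicator (Pi\<^sub>E {..<d} A) z \<partial>Nd d)"
      by (intro emeasure_density) (auto intro!: sets_PiM_I_finite)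
    also have "\<dots> = (\<integral>\<^sup>+z. (\<Prod>i<d. e (a i) (z i) * indicator (A i) (z i)) \<partial>Nd d)"
    proof (rule nn_integral_cong)
      fix z assume "z \<in> space (Nd d)"
      then have "indicator (Pi\<^sub>E {..<d} A) z = (\<Prod>i<d. indicator (A i) (z i) :: ennreal)"
        by (auto simp: space_Nd indicator_def PiE_iff extensional_def)
      then show "?E z * indicator (Pi\<^sub>E {..<d} A) z = (\<Prod>i<d. e (a i) (z i) * indicator (A i) (z i))"
        by (simp add: E_eq prod.distrib)
    qed
    also have "\<dots> = (\<Prod>i<d. \<integral>\<^sup>+z. e (a i) z * indicator (A i) z \<partial>N1)"
      unfolding Nd_def
      by (rule product_nn_integral_prod[where f = "\<lambda>i z. e (a i) z * indicator (A i) z"]) auto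
    also have "\<dots> = (\<Prod>i<d. emeasure (M i) (A i))"
      unfolding M_def by (intro prod.cong refl emeasure_density[symmetric]) auto
    finally show "emeasure (density (Nd d) ?E) (Pi\<^sub>E {..<d} A) = \<dots>" .
  qed (simp_all add: sets_PiM_M)
  have "(\<integral>\<^sup>+z. f (?T z) \<partial>Nd d) = (\<integral>\<^sup>+z. f z \<partial>distr (Nd d) (PiM {..<d} (\<lambda>_. borel)) ?T)"
    by (subst nn_integral_distr) auto
  also have "\<dots> = (\<integral>\<^sup>+z. f z \<partial>density (Nd d) ?E)"
    by (simp only: 1 2)
  also have "\<dots> = (\<integral>\<^sup>+z. ?E z * f z \<partial>Nd d)"
    by (intro nn_integral_density) auto
  finally show ?thesis .
qed

text \<open>Shearing $(z, w) \mapsto (z + w n, w)$ with $w = z_1 - n \cdot z$ turns the density into that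
  of $N(0, I_d)$ times a normal density in $w$ centred at $n \cdot z$.\<close>

lemma distr_Nd_replace_component:
  assumes "ip d n n = 1"
  shows "distr (Nd d \<Otimes>\<^sub>M N1) (Nd d) (\<lambda>(z, z1). \<lambda>i\<in>{..<d}. z i + (z1 - ip d n z) * n i) = Nd d"
proof (rule measure_eqI)
  interpret N1: prob_space N1 by simp
  interpret Nd: prob_space "Nd d" by simp
  interpret P: pair_prob_space "Nd d" N1 ..
  let ?T = "\<lambda>(z, z1). \<lambda>i\<in>{..<d}. z i + (z1 - ip d n z) * n i"
  have T [measurable]: "?T \<in> measurable (Nd d \<Otimes>\<^sub>M N1) (PiM {..<d} (\<lambda>_. borel))"
    by measurable
  fix A assume "A \<in> sets (distr (Nd d \<Otimes>\<^sub>M N1) (Nd d) ?T)"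
  then have A [measurable]: "A \<in> sets (PiM {..<d} (\<lambda>_. borel))" by simp
  define F :: "(nat \<Rightarrow> real) \<Rightarrow> ennreal" where "F = indicator A"
  have [measurable]: "F \<in> borel_measurable (PiM {..<d} (\<lambda>_. borel))"
    unfolding F_def by measurable
  let ?S = "\<lambda>z w. \<lambda>i\<in>{..<d}. z i + w * n i"
  let ?e = "\<lambda>c w::real. ennreal (exp (c * w - c\<^sup>2 / 2))"
  have ip_S: "ip d n (?S z w) = ip d n z + w" for z w
    using assms by (simp add: ip_def algebra_simps sum.distrib sum_distrib_left[symmetric])
  have "emeasure (distr (Nd d \<Otimes>\<^sub>M N1) (Nd d) ?T) A
      = (\<integral>\<^sup>+p. F p \<partial>distr (Nd d \<Otimes>\<^sub>M N1) (PiM {..<d} (\<lambda>_. borel)) ?T)"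
    unfolding F_def by (subst nn_integral_indicator) (auto intro!: arg_cong2[where f = emeasure] distr_cong)
  also have "\<dots> = (\<integral>\<^sup>+p. F (?T p) \<partial>(Nd d \<Otimes>\<^sub>M N1))"
    by (intro nn_integral_distr) auto
  also have "\<dots> = (\<integral>\<^sup>+z. \<integral>\<^sup>+z1. F (?S z (z1 - ip d n z)) \<partial>N1 \<partial>Nd d)"
    by (subst N1.nn_integral_fst[symmetric]) (auto simp: case_prod_beta)
  also have "\<dots> = (\<integral>\<^sup>+z. \<integral>\<^sup>+w. ?e (- ip d n z) w * F (?S z w) \<partial>N1 \<partial>Nd d)"
  proof (rule nn_integral_cong)
    fix z assume z: "z \<in> space (Nd d)"
    have [measurable]: "(\<lambda>w. F (?S z w)) \<in> borel_measurable borel"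
      by measurable
    show "(\<integral>\<^sup>+z1. F (?S z (z1 - ip d n z)) \<partial>N1) = (\<integral>\<^sup>+w. ?e (- ip d n z) w * F (?S z w) \<partial>N1)"
      using nn_integral_N1_shift[of "\<lambda>w. F (?S z w)" "- ip d n z"] by simp
  qed
  also have "\<dots> = (\<integral>\<^sup>+w. \<integral>\<^sup>+z. ?e (- ip d n z) w * F (?S z w) \<partial>Nd d \<partial>N1)"
    by (rule P.Fubini'[symmetric]) measurable
  also have "\<dots> = (\<integral>\<^sup>+w. \<integral>\<^sup>+z. ?e (ip d n z) w * F z \<partial>Nd d \<partial>N1)"
  proof (rule nn_integral_cong)
    fix w :: real
    \<comment> \<open>To translate by w n, the weight must be a function of the translated point z'
      = z + w n; since n is a unit vector, - n.z = w - n.z'. The translation density then turns the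
      exponent into w (n.z) - (n.z)^2 / 2.\<close>
    let ?G = "\<lambda>z. ?e (w - ip d n z) w * F z"
    have "(\<integral>\<^sup>+z. ?e (- ip d n z) w * F (?S z w) \<partial>Nd d) = (\<integral>\<^sup>+z. ?G (?S z w) \<partial>Nd d)"
      by (simp only: ip_S) simp
    also have "\<dots> = (\<integral>\<^sup>+z. ennreal (exp (w * ip d n z - w\<^sup>2 / 2)) * ?G z \<partial>Nd d)"
    proof -
      have ip_w: "ip d (\<lambda>i. w * n i) z = w * ip d n z" "ip d n (\<lambda>i. w * n i) = w" for z
        using assms by (simp_all add: ip_def sum_distrib_left[symmetric] mult.left_commute mult.assoc)
      have "?G \<in> borel_measurable (PiM {..<d} (\<lambda>_. borel))"
        by measurable
      from nn_integral_Nd_shift[OF this, of "\<lambda>i. w * n i"] show ?thesis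
        unfolding ip_w power2_eq_square[of w] .
    qed
    also have "\<dots> = (\<integral>\<^sup>+z. ?e (ip d n z) w * F z \<partial>Nd d)"
      unfolding mult.assoc[symmetric] ennreal_mult'[symmetric, OF exp_ge_zero] exp_add[symmetric]
      by (intro nn_integral_cong arg_cong2[where f = "(*)"] arg_cong[where f = ennreal] arg_cong[where f = exp])
         (auto simp: power2_eq_square field_simps)
    finally show "(\<integral>\<^sup>+z. ?e (- ip d n z) w * F (?S z w) \<partial>Nd d) = (\<integral>\<^sup>+z. ?e (ip d n z) w * F z \<partial>Nd d)" .
  qed
  also have "\<dots> = (\<integral>\<^sup>+z. \<integral>\<^sup>+w. ?e (ip d n z) w * F z \<partial>N1 \<partial>Nd d)"
    by (rule P.Fubini') measurable
  also have "\<dots> = (\<integral>\<^sup>+z. F z \<partial>Nd d)"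
  proof (rule nn_integral_cong)
    fix z
    \<comment> \<open>The weight is the density of N(n.z, 1) with respect to N(0,1), so its total
      mass is 1.\<close>
    have "(\<integral>\<^sup>+w. ?e (ip d n z) w \<partial>N1) = 1"
      using nn_integral_N1_shift[of "\<lambda>_. 1" "ip d n z"] N1.emeasure_space_1 by simp
    then show "(\<integral>\<^sup>+w. ?e (ip d n z) w * F z \<partial>N1) = F z"
      by (subst nn_integral_multc) auto
  qed
  also have "\<dots> = emeasure (Nd d) A"
    unfolding F_def by simp
  finally show "emeasure (distr (Nd d \<Otimes>\<^sub>M N1) (Nd d) ?T) A = emeasure (Nd d) A" .
qed simp

section \<open>The GCRN proposal: direction, marginal law and projection\<close>

lemma ip_self_nonneg: "0 \<le> ip d a a"
  by (simp add: ip_def sum_nonneg)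

lemma ip_self_eq_0_iff: "ip d a a = 0 \<longleftrightarrow> (\<forall>i<d. a i = 0)"
  by (auto simp: ip_def sum_nonneg_eq_0_iff)

text \<open>If the norm of X vanishes, division by zero makes the direction the zero vector and the
  proposal is Z unchanged. This degenerate case arises because x = 0 and y = 0 are allowed.\<close>

lemma ip_gcrn_dir_self: "ip d (gcrn_dir d X) (gcrn_dir d X) = (if ip d X X = 0 then 0 else 1)"
proof (cases "ip d X X = 0")
  case False
  have "ip d (gcrn_dir d X) (gcrn_dir d X) = (\<Sum>i<d. X i * X i / ip d X X)"
    unfolding ip_def[of d "gcrn_dir d X" "gcrn_dir d X"]
    using ip_self_nonneg[of d X] by (simp add: gcrn_dir_def)
  then show ?thesis
    using False by (simp add: sum_divide_distrib[symmetric] ip_def[symmetric])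
qed (auto simp: ip_self_eq_0_iff gcrn_dir_def)

lemma gcrn_prop_alt:
  "gcrn_prop d X z z1 = (\<lambda>i\<in>{..<d}. z i + (z1 - ip d (gcrn_dir d X) z) * gcrn_dir d X i)"
  by (auto simp: gcrn_prop_def algebra_simps)

lemma measurable_gcrn_prop [measurable]:
  "(\<lambda>(z, z1). gcrn_prop d X z z1) \<in> measurable (Nd d \<Otimes>\<^sub>M N1) (PiM {..<d} (\<lambda>_. borel))"
  unfolding gcrn_prop_alt by measurable

lemma distr_Nd_N1_fst: "distr (Nd d \<Otimes>\<^sub>M N1) (Nd d) fst = Nd d"
  by (simp add: prob_space.distr_pair_fst)

lemma distr_pair_snd:
  assumes "prob_space M" "prob_space N"
  shows "distr (M \<Otimes>\<^sub>M N) N snd = N"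
proof -
  interpret M: prob_space M by fact
  interpret N: prob_space N by fact
  interpret P: pair_prob_space M N ..
  have "distr (M \<Otimes>\<^sub>M N) N snd = distr (N \<Otimes>\<^sub>M M) N (snd \<circ> (\<lambda>(x, y). (y, x)))"
    by (subst P.distr_pair_swap) (simp add: distr_distr)
  also have "snd \<circ> (\<lambda>(x, y). (y, x)) = fst"
    by auto
  finally show ?thesis
    using M.distr_pair_fst[of N] by simp
qed

lemma distr_Nd_N1_snd: "distr (Nd d \<Otimes>\<^sub>M N1) N1 snd = N1"
  by (simp add: distr_pair_snd)

lemma distr_gcrn_prop: "distr (Nd d \<Otimes>\<^sub>M N1) (Nd d) (\<lambda>(z, z1). gcrn_prop d X z z1) = Nd d"
proof (cases "ip d X X = 0")
  case True
  have "distr (Nd d \<Otimes>\<^sub>M N1) (Nd d) (\<lambda>(z, z1). gcrn_prop d X z z1) = distr (Nd d \<Otimes>\<^sub>M N1) (Nd d) fst"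
    using True
    by (intro distr_cong)
       (auto simp: gcrn_prop_def ip_self_eq_0_iff gcrn_dir_def space_pair_measure space_Nd
          PiE_def extensional_def)
  then show ?thesis
    by (simp add: distr_Nd_N1_fst)
next
  case False
  then show ?thesis
    unfolding gcrn_prop_alt by (intro distr_Nd_replace_component) (simp add: ip_gcrn_dir_self)
qed

text \<open>The component along n is exactly z1, and X = - ||X|| n. With one z1 shared by both
  chains, the projections on X and on Y are nonnegative multiples of the same variable - z1, hence
  comonotone.\<close>

lemma ip_gcrn_prop: "ip d X (gcrn_prop d X z z1) = - sqrt (ip d X X) * z1"
proof (cases "ip d X X = 0")
  case True
  then have "\<forall>i<d. X i = 0"
    by (simp add: ip_self_eq_0_iff)
  then have "ip d X w = 0" for w
    by (simp add: ip_def)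
  then show ?thesis
    by simp
next
  case False
  let ?n = "gcrn_dir d X"
  have X: "X i = - sqrt (ip d X X) * ?n i" for i
    using False by (simp add: gcrn_dir_def)
  have "ip d X (gcrn_prop d X z z1) = - sqrt (ip d X X) * ip d ?n (gcrn_prop d X z z1)"
    by (subst X[abs_def], subst ip_def) (simp add: ip_def[of d ?n] sum_distrib_left mult_ac sum_negf)
  also have "ip d ?n (gcrn_prop d X z z1)
      = (\<Sum>i<d. ?n i * z i + (z1 - ip d ?n z) * (?n i * ?n i))"
    unfolding gcrn_prop_alt by (subst ip_def) (auto intro!: sum.cong simp: algebra_simps)
  also have "\<dots> = ip d ?n z + (z1 - ip d ?n z) * ip d ?n ?n"
    by (simp add: sum.distrib sum_distrib_left[symmetric] ip_def[symmetric])
  also have "\<dots> = z1"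
    using False by (simp add: ip_gcrn_dir_self)
  finally show ?thesis .
qed

lemma distr_N1_uminus: "distr N1 borel uminus = N1"
proof (rule measure_eqI)
  fix A assume "A \<in> sets (distr N1 borel (uminus :: real \<Rightarrow> real))"
  then have [measurable]: "A \<in> sets borel" by simp
  have "emeasure (distr N1 borel uminus) A = (\<integral>\<^sup>+z. indicator A z \<partial>distr N1 borel uminus)"
    by simp
  also have "\<dots> = (\<integral>\<^sup>+z. indicator A (- z) \<partial>N1)"
    by (subst nn_integral_distr) auto
  also have "\<dots> = (\<integral>\<^sup>+z. ennreal (std_normal_density z) * indicator A (- z) \<partial>lborel)"
    unfolding N1_def by (subst nn_integral_density) auto
  also have "\<dots> = (\<integral>\<^sup>+z. ennreal (std_normal_density z) * indicator A z \<partial>lborel)"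
    by (subst nn_integral_real_affine[where c = "-1" and t = 0]) (auto simp: std_normal_density_def)
  also have "\<dots> = emeasure N1 A"
    unfolding N1_def by (subst emeasure_density) auto
  finally show "emeasure (distr N1 borel uminus) A = emeasure N1 A" .
qed simp

text \<open>This replaces rotation invariance: the GCRN proposal has law \<open>Nd d\<close>, and
  its projection on X is - ||X|| z1; symmetry of the normal law removes the sign.\<close>

lemma distr_Nd_ip: "distr (Nd d) borel (ip d X) = distr N1 borel (\<lambda>z. sqrt (ip d X X) * z)"
proof -
  have "distr (Nd d) borel (ip d X)
      = distr (distr (Nd d \<Otimes>\<^sub>M N1) (Nd d) (\<lambda>(z, z1). gcrn_prop d X z z1)) borel (ip d X)"
    by (simp add: distr_gcrn_prop)
  also have "\<dots> = distr (Nd d \<Otimes>\<^sub>M N1) borel (\<lambda>p. - sqrt (ip d X X) * snd p)"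
    by (subst distr_distr) (auto simp: comp_def ip_gcrn_prop case_prod_beta)
  also have "\<dots> = distr (distr (distr (Nd d \<Otimes>\<^sub>M N1) N1 snd) borel uminus) borel (\<lambda>z. sqrt (ip d X X) * z)"
    by (simp add: distr_distr comp_def)
  finally show ?thesis
    by (simp only: distr_Nd_N1_snd distr_N1_uminus)
qed

section \<open>Gaussian moments and concentration of the squared norm\<close>

lemma has_bochner_integral_N1_even:
  "has_bochner_integral N1 (\<lambda>z. z ^ (2 * k)) (fact (2 * k) / (2 ^ k * fact k))"
  unfolding N1_def
  by (rule has_bochner_integral_density) (use std_normal_moment_even[of k] in auto)

lemma integrable_N1_sq: "integrable N1 (\<lambda>z. z\<^sup>2)" and integral_N1_sq: "(\<integral>z. z\<^sup>2 \<partial>N1) = 1"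
  using has_bochner_integral_N1_even[of 1] by (auto simp: has_bochner_integral_iff)

lemma has_bochner_integral_N1_sq_minus_1:
  "has_bochner_integral N1 (\<lambda>z. z\<^sup>2 - 1) 0"
  "has_bochner_integral N1 (\<lambda>z. (z\<^sup>2 - 1) * (z\<^sup>2 - 1)) 2"
proof -
  interpret N1: prob_space N1 by simp
  have 1: "has_bochner_integral N1 (\<lambda>z. 1) (1::real)"
    using N1.prob_space by (simp add: has_bochner_integral_iff)
  have 2: "has_bochner_integral N1 (\<lambda>z. z\<^sup>2) 1"
    using has_bochner_integral_N1_even[of 1] by simp
  have 4: "has_bochner_integral N1 (\<lambda>z. z ^ 4) 3"
    using has_bochner_integral_N1_even[of 2] by (simp add: fact_numeral)
  show "has_bochner_integral N1 (\<lambda>z. z\<^sup>2 - 1) 0"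
    using has_bochner_integral_diff[OF 2 1] by simp
  have "has_bochner_integral N1 (\<lambda>z. z ^ 4 - 2 * z\<^sup>2 + 1) (3 - 2 * 1 + 1)"
    by (intro has_bochner_integral_add has_bochner_integral_diff has_bochner_integral_mult_right 1 2 4)
  then show "has_bochner_integral N1 (\<lambda>z. (z\<^sup>2 - 1) * (z\<^sup>2 - 1)) 2"
    by (simp add: algebra_simps power2_eq_square power4_eq_xxxx)
qed

lemma integrable_Nd_ip_sq: "integrable (Nd d) (\<lambda>z. (ip d X z)\<^sup>2)"
  and integral_Nd_ip_sq: "(\<integral>z. (ip d X z)\<^sup>2 \<partial>Nd d) = ip d X X"
proof -
  have [measurable]: "ip d X \<in> measurable (Nd d) borel"
    by measurable
  have "integrable (distr (Nd d) borel (ip d X)) (\<lambda>u. u\<^sup>2)"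
    unfolding distr_Nd_ip by (subst integrable_distr_eq) (auto simp: power_mult_distrib integrable_N1_sq)
  then show "integrable (Nd d) (\<lambda>z. (ip d X z)\<^sup>2)"
    by (subst (asm) integrable_distr_eq) auto
  have "(\<integral>z. (ip d X z)\<^sup>2 \<partial>Nd d) = (\<integral>u. u\<^sup>2 \<partial>distr (Nd d) borel (ip d X))"
    by (subst integral_distr) auto
  also have "\<dots> = ip d X X"
    unfolding distr_Nd_ip using ip_self_nonneg[of d X]
    by (subst integral_distr) (auto simp: power_mult_distrib integral_N1_sq)
  finally show "(\<integral>z. (ip d X z)\<^sup>2 \<partial>Nd d) = ip d X X" .
qed

lemma has_bochner_integral_Nd_prod2:
  assumes "i < d" "j < d" and g: "has_bochner_integral N1 g 0" and g2: "has_bochner_integral N1 (\<lambda>z. g z * g z) c"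
  shows "has_bochner_integral (Nd d) (\<lambda>z. g (z i) * g (z j)) (if i = j then c else 0 :: real)"
proof -
  interpret N1: prob_space N1 by simp
  interpret product_sigma_finite "\<lambda>_::nat. N1"
    by (rule product_sigma_finite.intro) (simp add: prob_space_imp_sigma_finite)
  \<comment> \<open>When i = j both factors sit on one coordinate, so G is the square there; a
    single product over the set {i, j} then covers both cases.\<close>
  define G where "G = (if i = j then (\<lambda>t. g t * g t) else g)"
  define f where "f = (\<lambda>k::nat. if k \<in> {i, j} then G else (\<lambda>_. 1))"
  have eq: "g (z i) * g (z j) = (\<Prod>k<d. f k (z k))" for z
  proof -
    have "(\<Prod>k<d. f k (z k)) = (\<Prod>k<d. if k \<in> {i, j} then G (z k) else 1)"
      by (intro prod.cong) (auto simp: f_def)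
    also have "\<dots> = prod (\<lambda>k. G (z k)) ({..<d} \<inter> {i, j})"
      by (rule prod.inter_restrict[symmetric]) simp
    also have "{..<d} \<inter> {i, j} = {i, j}"
      using assms by auto
    finally show ?thesis
      by (cases "i = j") (simp_all add: G_def)
  qed
  have int: "integrable N1 (f k)" for k
    using g g2 by (auto simp: f_def G_def has_bochner_integral_iff)
  have "(\<integral>z. g (z i) * g (z j) \<partial>Nd d) = (\<Prod>k<d. integral\<^sup>L N1 (f k))"
    unfolding eq Nd_def by (intro product_integral_prod int) simp
  also have "\<dots> = (\<Prod>k<d. if k \<in> {i, j} then integral\<^sup>L N1 G else 1)"
    using N1.prob_space by (intro prod.cong) (auto simp: f_def)
  also have "\<dots> = prod (\<lambda>k. integral\<^sup>L N1 G) ({..<d} \<inter> {i, j})"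
    by (rule prod.inter_restrict[symmetric]) simp
  also have "{..<d} \<inter> {i, j} = {i, j}"
    using assms by auto
  also have "prod (\<lambda>k. integral\<^sup>L N1 G) {i, j} = (if i = j then c else 0)"
    using g g2 by (auto simp: G_def has_bochner_integral_iff)
  finally have "(\<integral>z. g (z i) * g (z j) \<partial>Nd d) = (if i = j then c else 0)" .
  moreover have "integrable (Nd d) (\<lambda>z. g (z i) * g (z j))"
    unfolding eq Nd_def by (intro product_integrable_prod int) simp
  ultimately show ?thesis
    by (simp add: has_bochner_integral_iff)
qed

text \<open>||Z||^2 - d is the sum of the independent centred variables Z_i^2 - 1. Off-diagonal
  products vanish, and each diagonal one contributes E Z^4 - 2 E Z^2 + 1 = 2.\<close>

lemma has_bochner_integral_Nd_norm_sq_deviation: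
  "has_bochner_integral (Nd d) (\<lambda>z. (ip d z z - real d)\<^sup>2) (2 * real d)"
proof -
  let ?g = "\<lambda>t::real. t\<^sup>2 - 1"
  have "has_bochner_integral (Nd d) (\<lambda>z. \<Sum>i<d. \<Sum>j<d. ?g (z i) * ?g (z j))
      (\<Sum>i<d. \<Sum>j<d. if i = j then 2 else 0)"
    by (intro has_bochner_integral_sum has_bochner_integral_Nd_prod2 has_bochner_integral_N1_sq_minus_1) auto
  also have "(\<lambda>z. \<Sum>i<d. \<Sum>j<d. ?g (z i) * ?g (z j)) = (\<lambda>z. (ip d z z - real d)\<^sup>2)"
    by (simp add: sum_product[symmetric] sum_subtractf ip_def power2_eq_square)
  also have "(\<Sum>i<d. \<Sum>j<d. if i = j then 2 else 0) = 2 * real d"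
    by simp
  finally show ?thesis .
qed

lemma integrable_Nd_norm_sq: "integrable (Nd d) (\<lambda>z. ip d z z)"
proof -
  interpret prob_space "Nd d" by simp
  have "integrable (Nd d) (\<lambda>z. ip d z z - real d)"
    by (rule square_integrable_imp_integrable)
       (use has_bochner_integral_Nd_norm_sq_deviation in \<open>auto simp: has_bochner_integral_iff\<close>)
  then have "integrable (Nd d) (\<lambda>z. (ip d z z - real d) + real d)"
    by (intro Bochner_Integration.integrable_add) auto
  then show ?thesis by simp
qed

text \<open>Jensen's inequality, in the form that the variance of the absolute deviation is
  nonnegative.\<close>

lemma integral_Nd_norm_sq_deviation_le: "(\<integral>z. \<bar>ip d z z - real d\<bar> \<partial>Nd d) \<le> sqrt (2 * real d)"
proof -
  interpret prob_space "Nd d" by simp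
  let ?f = "\<lambda>z. \<bar>ip d z z - real d\<bar>"
  have f: "integrable (Nd d) ?f"
    using integrable_Nd_norm_sq by auto
  have "0 \<le> variance ?f"
    by simp
  also have "variance ?f = (\<integral>z. (?f z)\<^sup>2 \<partial>Nd d) - (expectation ?f)\<^sup>2"
    using has_bochner_integral_Nd_norm_sq_deviation
    by (intro variance_eq f) (auto simp: has_bochner_integral_iff)
  finally have "(expectation ?f)\<^sup>2 \<le> 2 * real d"
    using has_bochner_integral_Nd_norm_sq_deviation by (simp add: has_bochner_integral_iff)
  then show ?thesis
    by (rule real_le_rsqrt)
qed

section \<open>The joint acceptance profile and its dual potentials\<close>

lemma exp_nonpos_lipschitz:
  fixes p q :: real
  assumes "p \<le> 0" "q \<le> 0"
  shows "\<bar>exp p - exp q\<bar> \<le> \<bar>p - q\<bar>"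
proof -
  have *: "exp b - exp a \<le> b - a" if "a \<le> b" "b \<le> 0" for a b :: real
  proof -
    have "exp b - exp a = exp b * (1 - exp (a - b))"
      by (simp add: right_diff_distrib exp_diff)
    also have "\<dots> \<le> 1 * (b - a)"
    proof (rule mult_mono)
      show "1 - exp (a - b) \<le> b - a"
        using exp_ge_add_one_self[of "a - b"] by linarith
    qed (use that in auto)
    finally show ?thesis by simp
  qed
  show ?thesis
    using *[of p q] *[of q p] assms by (cases p q rule: linorder_cases) auto
qed

text \<open>The arguments stand for $u = h\,X \cdot Z_x$, $s = h^2 \|Z_x\|^2$, $w = h\,Y \cdot Z_y$,
  $t = h^2 \|Z_y\|^2$.\<close>

definition joint_acc :: "real \<Rightarrow> real \<Rightarrow> real \<Rightarrow> real \<Rightarrow> real" where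
  "joint_acc u s w t = min 1 (min (exp (- u - s / 2)) (exp (- w - t / 2)))"

lemma joint_acc_bounds: "0 \<le> joint_acc u s w t" "joint_acc u s w t \<le> 1"
  by (auto simp: joint_acc_def)

lemma measurable_joint_acc [measurable (raw)]:
  assumes "f \<in> borel_measurable M" "g \<in> borel_measurable M"
    "f' \<in> borel_measurable M" "g' \<in> borel_measurable M"
  shows "(\<lambda>x. joint_acc (f x) (g x) (f' x) (g' x)) \<in> borel_measurable M"
  unfolding joint_acc_def using assms by measurable

text \<open>Moving the minimum inside gives exp of min 0 (...), and exp is 1-Lipschitz on
  nonpositive arguments. The bound allows the random squared norms to be frozen at a constant a,
  leaving the projections as the only random arguments.\<close>

lemma joint_acc_lipschitz:
  "\<bar>joint_acc u s w t - joint_acc u a w a\<bar> \<le> (\<bar>s - a\<bar> + \<bar>t - a\<bar>) / 2"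
proof -
  have min_diff: "\<bar>min 0 (min p q) - min 0 (min p' q')\<bar> \<le> \<bar>p - p'\<bar> + \<bar>q - q'\<bar>" for p q p' q' :: real
    by linarith
  have eq: "joint_acc u s w t = exp (min 0 (min (- u - s / 2) (- w - t / 2)))" for u s w t
    by (auto simp: joint_acc_def min_def)
  show ?thesis
    unfolding eq
  proof (rule order_trans[OF exp_nonpos_lipschitz])
    show "\<bar>min 0 (min (- u - s / 2) (- w - t / 2)) - min 0 (min (- u - a / 2) (- w - a / 2))\<bar>
        \<le> (\<bar>s - a\<bar> + \<bar>t - a\<bar>) / 2"
      using min_diff[of "- u - s / 2" "- w - t / 2" "- u - a / 2" "- w - a / 2"] by argo
  qed simp_all
qed

text \<open>Kantorovich potentials certifying that the comonotone coupling is optimal for the reward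
  \<open>joint_acc\<close>: cut both profiles at their common value at the crossing point \<open>0\<close>.\<close>

lemma joint_acc_potentials:
  assumes "0 \<le> a" "0 \<le> b" "0 \<le> s"
  obtains p q :: "real \<Rightarrow> real"
  where "p \<in> borel_measurable borel" "q \<in> borel_measurable borel"
    "\<And>u. \<bar>p u\<bar> \<le> 1" "\<And>w. \<bar>q w\<bar> \<le> 1"
    "\<And>u w. joint_acc u s w s \<le> p u + q w"
    "\<And>z. joint_acc (a * z) s (b * z) s = p (a * z) + q (b * z)"
proof -
  define c where "c = exp (- s / 2)"
  have c: "0 < c" "c \<le> 1"
    using assms by (auto simp: c_def)
  define f where "f = (\<lambda>u. min 1 (exp (- u - s / 2)))"
  \<comment> \<open>p keeps the part of the profile below c, q the excess above c. The sum dominates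
    min (f u) (f w), because any part of that minimum above c is covered by the excess of f
    w.\<close>
  define p q where "p = (\<lambda>u. min (f u) c)" and "q = (\<lambda>w. max (f w) c - c)"
  have [measurable]: "p \<in> borel_measurable borel" "q \<in> borel_measurable borel"
    unfolding p_def q_def f_def by measurable
  have f: "0 < f u" "f u \<le> 1" for u
    by (auto simp: f_def)
  have J: "joint_acc u s w s = min (f u) (f w)" for u w
    by (auto simp: joint_acc_def f_def)
  have bounds: "\<bar>p u\<bar> \<le> 1" "\<bar>q u\<bar> \<le> 1" for u
    using f[of u] c by (auto simp: p_def q_def)
  have le: "joint_acc u s w s \<le> p u + q w" for u w
    using f[of u] f[of w] c by (auto simp: J p_def q_def min_def max_def)
  have mono: "f u \<le> f w" if "w \<le> u" for u w
    using that by (auto simp: f_def min_def)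
  have f0: "f 0 = c"
    using c by (simp add: f_def c_def)
  \<comment> \<open>The capped profile must be the one with the larger slope. For z >= 0, f (a z) <=
    f (b z) <= c and both sides are f (a z); for z < 0, c <= f (b z) <= f (a z) and both sides are f
    (b z).\<close>
  have eq: "min (f (a * z)) (f (b * z)) = p (a * z) + q (b * z)" if "b \<le> a" "0 \<le> b" for a b z
  proof (cases "0 \<le> z")
    case True
    then have "b * z \<le> a * z" "0 \<le> b * z"
      using that by (auto intro: mult_right_mono)
    then show ?thesis
      using mono[of "b * z" "a * z"] mono[of 0 "b * z"] f0 by (auto simp: p_def q_def)
  next
    case False
    then have "a * z \<le> b * z" "b * z \<le> 0"
      using that by (auto intro: mult_right_mono_neg mult_nonneg_nonpos)
    then show ?thesis
      using mono[of "a * z" "b * z"] mono[of "b * z" 0] f0 by (auto simp: p_def q_def)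
  qed
  show ?thesis
  proof (cases "b \<le> a")
    case True
    then show ?thesis
      using assms by (intro that[of p q]) (auto simp: bounds le J[of "a * _"] eq)
  next
    case False
    then have "min (f (a * z)) (f (b * z)) = q (a * z) + p (b * z)" for z
      using eq[of a b z] assms by (simp add: min.commute add.commute)
    moreover have "joint_acc u s w s \<le> q u + p w" for u w
      using le[of w u] by (simp add: J min.commute add.commute)
    ultimately show ?thesis
      by (intro that[of q p]) (auto simp: bounds J[of "a * _"])
  qed
qed

section \<open>Couplings, their marginals and the Frechet bound\<close>

lemma is_couplingD:
  assumes "is_coupling M C"
  shows "prob_space C" "sets C = sets (M \<Otimes>\<^sub>M M)" "distr C M fst = M" "distr C M snd = M"
  using assms by (auto simp: is_coupling_def)

lemma integrable_distr_eq_self: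
  fixes f :: "'a \<Rightarrow> real"
  assumes "T \<in> measurable C M" "distr C M T = M" "integrable M f"
  shows "integrable C (\<lambda>z. f (T z))" "(\<integral>z. f (T z) \<partial>C) = (\<integral>z. f z \<partial>M)"
  using assms integrable_distr[of T C M f] integral_distr[of T C M f] by simp_all

lemma coupling_marginal:
  fixes f :: "'a \<Rightarrow> real"
  assumes "is_coupling M C" "integrable M f"
  shows "integrable C (\<lambda>z. f (fst z))" "(\<integral>z. f (fst z) \<partial>C) = (\<integral>z. f z \<partial>M)"
    "integrable C (\<lambda>z. f (snd z))" "(\<integral>z. f (snd z) \<partial>C) = (\<integral>z. f z \<partial>M)"
proof -
  note C = is_couplingD[OF assms(1)]
  have "fst \<in> measurable C M" "snd \<in> measurable C M"
    using measurable_cong_sets[OF C(2) refl] by auto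
  then show "integrable C (\<lambda>z. f (fst z))" "(\<integral>z. f (fst z) \<partial>C) = (\<integral>z. f z \<partial>M)"
    "integrable C (\<lambda>z. f (snd z))" "(\<integral>z. f (snd z) \<partial>C) = (\<integral>z. f z \<partial>M)"
    using integrable_distr_eq_self C assms(2) by blast+
qed

lemma measure_unif01_atMost:
  assumes "0 \<le> a"
  shows "measure unif01 {..a} = min 1 a"
proof -
  have "{0..1} \<inter> {..a} = {0..min 1 a}"
    by auto
  then show ?thesis
    using assms unfolding unif01_def by (subst measure_uniform_measure) auto
qed

text \<open>Frechet-Hoeffding upper bound: the rectangle lies in the strip over each of its sides,
  and each strip has a uniform marginal mass. Levels above 1 occur because acceptance ratios are not
  truncated.\<close>

lemma coupling_unif01_rect_le:
  assumes "is_coupling unif01 C" "0 \<le> a" "0 \<le> b"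
  shows "measure C ({..a} \<times> {..b}) \<le> min 1 (min a b)"
proof -
  note C = is_couplingD[OF assms(1)]
  interpret prob_space C by (rule C(1))
  have sets_C [simp, measurable_cong]: "sets C = sets (borel \<Otimes>\<^sub>M borel)"
    using C(2) by (simp cong: sets_pair_measure_cong)
  have sp: "space C = UNIV"
    using sets_eq_imp_space_eq[OF sets_C] by (simp add: space_pair_measure)
  have "measure C ({..a} \<times> {..b}) \<le> measure C (fst -` {..a} \<inter> space C)"
    by (intro finite_measure_mono measurable_sets[of _ _ borel]) (auto simp: sp)
  also have "\<dots> = measure (distr C unif01 fst) {..a}"
    by (subst measure_distr) auto
  also have "\<dots> = min 1 a"
    using assms by (simp add: C measure_unif01_atMost)
  finally have 1: "measure C ({..a} \<times> {..b}) \<le> min 1 a" .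
  have "measure C ({..a} \<times> {..b}) \<le> measure C (snd -` {..b} \<inter> space C)"
    by (intro finite_measure_mono measurable_sets[of _ _ borel]) (auto simp: sp)
  also have "\<dots> = measure (distr C unif01 snd) {..b}"
    by (subst measure_distr) auto
  also have "\<dots> = min 1 b"
    using assms by (simp add: C measure_unif01_atMost)
  finally show ?thesis
    using 1 by simp
qed

text \<open>The diagonal coupling attains the Frechet bound, so accepting with a common uniform
  loses nothing.\<close>

lemma gcrn_U_rect:
  assumes "0 \<le> a" "0 \<le> b"
  shows "measure gcrn_U ({..a} \<times> {..b}) = min 1 (min a b)"
proof -
  have "measure gcrn_U ({..a} \<times> {..b}) = measure unif01 ((\<lambda>u. (u, u)) -` ({..a} \<times> {..b}) \<inter> space unif01)"
    unfolding gcrn_U_def by (intro measure_distr) measurable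
  also have "(\<lambda>u. (u, u)) -` ({..a} \<times> {..b}) \<inter> space unif01 = {..min a b}"
    by auto
  finally show ?thesis
    using assms by (simp add: measure_unif01_atMost)
qed

lemma is_coupling_gcrn_U: "is_coupling unif01 gcrn_U"
proof -
  have [measurable]: "(\<lambda>u::real. (u, u)) \<in> measurable unif01 (unif01 \<Otimes>\<^sub>M unif01)"
    by measurable
  have "prob_space gcrn_U"
    unfolding gcrn_U_def by (intro prob_space.prob_space_distr) auto
  then show ?thesis
    by (simp add: is_coupling_def) (simp add: gcrn_U_def distr_distr comp_def distr_id2)
qed

lemma is_coupling_gcrn_Z: "is_coupling (Nd d) (gcrn_Z d X Y)"
proof -
  interpret N1: prob_space N1 by simp
  interpret Nd: prob_space "Nd d" by simp
  interpret P: pair_prob_space "Nd d" N1 ..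
  let ?G = "\<lambda>(z, z1). (gcrn_prop d X z z1, gcrn_prop d Y z z1)"
  have [measurable]: "?G \<in> measurable (Nd d \<Otimes>\<^sub>M N1) (Nd d \<Otimes>\<^sub>M Nd d)"
    by (simp add: case_prod_beta') measurable
  have "prob_space (gcrn_Z d X Y)"
    unfolding gcrn_Z_def by (intro P.prob_space_distr) auto
  moreover have "distr (gcrn_Z d X Y) (Nd d) fst = Nd d" "distr (gcrn_Z d X Y) (Nd d) snd = Nd d"
    unfolding gcrn_Z_def
    using distr_gcrn_prop[of d X] distr_gcrn_prop[of d Y]
    by (simp_all add: distr_distr comp_def case_prod_beta')
  ultimately show ?thesis
    by (simp add: is_coupling_def) (simp add: gcrn_Z_def)
qed

section \<open>Integrating out the uniforms and pointwise bounds on the cross term\<close>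

lemma two_ip_le: "2 * \<bar>ip d a b\<bar> \<le> ip d a a + ip d b b"
proof -
  have "2 * \<bar>ip d a b\<bar> \<le> (\<Sum>i<d. 2 * \<bar>a i * b i\<bar>)"
    unfolding ip_def sum_distrib_left[symmetric] by (intro mult_left_mono sum_abs) auto
  also have "\<dots> \<le> (\<Sum>i<d. a i * a i + b i * b i)"
  proof (intro sum_mono)
    fix i
    have "0 \<le> (a i - b i)\<^sup>2" "0 \<le> (a i + b i)\<^sup>2"
      by auto
    then show "2 * \<bar>a i * b i\<bar> \<le> a i * a i + b i * b i"
      by (auto simp: power2_eq_square algebra_simps abs_if)
  qed
  also have "\<dots> = ip d a a + ip d b b"
    by (simp add: ip_def sum.distrib)
  finally show ?thesis .
qed

text \<open>Under the product law the uniforms can be integrated first with the proposals held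
  fixed. The two acceptance indicators then become the \<open>CU\<close>-mass of a
  rectangle.\<close>

lemma rwm_cross_fubini:
  fixes h :: real and X Y :: "nat \<Rightarrow> real"
  assumes CU: "is_coupling unif01 CU" and CZ: "is_coupling (Nd d) CZ"
  defines "F \<equiv> \<lambda>z. h\<^sup>2 * ip d (fst z) (snd z) *
    measure CU ({..exp (- h * ip d X (fst z) - h\<^sup>2 * ip d (fst z) (fst z) / 2)} \<times>
                {..exp (- h * ip d Y (snd z) - h\<^sup>2 * ip d (snd z) (snd z) / 2)})"
  shows "rwm_cross d h X Y CU CZ = (\<integral>z. F z \<partial>CZ)" and "integrable CZ F"
proof -
  note U = is_couplingD[OF CU] and Z = is_couplingD[OF CZ]
  interpret U: prob_space CU by (rule U(1))
  interpret Z: prob_space CZ by (rule Z(1))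
  interpret P: pair_prob_space CU CZ ..
  have [simp, measurable_cong]: "sets CU = sets (borel \<Otimes>\<^sub>M borel)"
    using U(2) by (simp cong: sets_pair_measure_cong)
  have [simp, measurable_cong]:
    "sets CZ = sets (PiM {..<d} (\<lambda>_. borel) \<Otimes>\<^sub>M PiM {..<d} (\<lambda>_. borel))"
    using Z(2) by (simp cong: sets_pair_measure_cong)
  let ?f = "\<lambda>u z. h\<^sup>2 * ip d (fst z) (snd z) * accept d h X (fst z) (fst u) * accept d h Y (snd z) (snd u)"
  have [measurable]: "(\<lambda>(u, z). ?f u z) \<in> borel_measurable (CU \<Otimes>\<^sub>M CZ)"
    unfolding accept_def by measurable
  \<comment> \<open>This dominating function is a sum over the two proposals, so its integrability
    follows from the marginals alone.\<close>
  have "integrable CZ (\<lambda>z. h\<^sup>2 * (ip d (fst z) (fst z) + ip d (snd z) (snd z)))"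
    using coupling_marginal[OF CZ integrable_Nd_norm_sq] by auto
  then have "integrable (CU \<Otimes>\<^sub>M CZ) (\<lambda>p. h\<^sup>2 * (ip d (fst (snd p)) (fst (snd p)) + ip d (snd (snd p)) (snd (snd p))))"
    by (intro integrable_distr_eq_self[where T = snd and M = CZ] distr_pair_snd U(1) Z(1)) auto
  then have int: "integrable (CU \<Otimes>\<^sub>M CZ) (\<lambda>(u, z). ?f u z)"
  proof (rule Bochner_Integration.integrable_bound)
    show "AE p in CU \<Otimes>\<^sub>M CZ. norm (case p of (u, z) \<Rightarrow> ?f u z)
        \<le> norm (h\<^sup>2 * (ip d (fst (snd p)) (fst (snd p)) + ip d (snd (snd p)) (snd (snd p))))"
    proof (intro AE_I2)
      fix p :: "(real \<times> real) \<times> (nat \<Rightarrow> real) \<times> (nat \<Rightarrow> real)"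
      have "\<bar>ip d (fst (snd p)) (snd (snd p))\<bar> \<le> ip d (fst (snd p)) (fst (snd p)) + ip d (snd (snd p)) (snd (snd p))"
        using two_ip_le[of d "fst (snd p)" "snd (snd p)"] by linarith
      then show "norm (case p of (u, z) \<Rightarrow> ?f u z)
        \<le> norm (h\<^sup>2 * (ip d (fst (snd p)) (fst (snd p)) + ip d (snd (snd p)) (snd (snd p))))"
        by (auto simp: accept_def abs_mult case_prod_beta ip_self_nonneg intro!: mult_left_mono)
    qed
  qed measurable
  have F: "(\<integral>u. ?f u z \<partial>CU) = F z" for z
  proof -
    let ?R = "{..exp (- h * ip d X (fst z) - h\<^sup>2 * ip d (fst z) (fst z) / 2)} \<times>
                {..exp (- h * ip d Y (snd z) - h\<^sup>2 * ip d (snd z) (snd z) / 2)}"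
    have "(\<integral>u. ?f u z \<partial>CU) = (\<integral>u. h\<^sup>2 * ip d (fst z) (snd z) * indicator ?R u \<partial>CU)"
      by (intro Bochner_Integration.integral_cong) (auto simp: accept_def indicator_def)
    also have "\<dots> = F z"
    proof -
      have "?R \<in> sets CU" by simp
      then show ?thesis
        unfolding F_def by (simp add: U.emeasure_eq_measure)
    qed
    finally show ?thesis .
  qed
  have "rwm_cross d h X Y CU CZ = (\<integral>p. (case p of (u, z) \<Rightarrow> ?f u z) \<partial>(CU \<Otimes>\<^sub>M CZ))"
    unfolding rwm_cross_def by (intro Bochner_Integration.integral_cong) auto
  also have "\<dots> = (\<integral>z. (\<integral>u. ?f u z \<partial>CU) \<partial>CZ)"
    by (rule P.integral_snd[OF int, symmetric])
  finally show "rwm_cross d h X Y CU CZ = (\<integral>z. F z \<partial>CZ)"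
    by (simp add: F)
  show "integrable CZ F"
    using P.integrable_snd[OF int] by (simp add: F)
qed

text \<open>With D half the total deviation, replacing c by a costs D (as Q <= 1) and freezing the
  profile costs a D; the sum is (a + 1) D. Here Q is the rectangle mass and c stands for h^2 Z_x .
  Z_y.\<close>

lemma accepted_product_le:
  fixes a :: real
  assumes "2 * \<bar>c\<bar> \<le> s + t" "0 \<le> Q" "Q \<le> joint_acc u s w t" "0 \<le> a"
  shows "c * Q \<le> a * joint_acc u a w a + (a + 1) / 2 * (\<bar>s - a\<bar> + \<bar>t - a\<bar>)"
proof -
  define D where "D = (\<bar>s - a\<bar> + \<bar>t - a\<bar>) / 2"
  have Q1: "Q \<le> 1"
    using assms(3) joint_acc_bounds(2)[of u s w t] by linarith
  have "c \<le> a + D" "0 \<le> D"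
    using assms(1) unfolding D_def by argo+
  have J: "joint_acc u s w t \<le> joint_acc u a w a + D"
    using joint_acc_lipschitz[of u s w t a] unfolding D_def by linarith
  have "c * Q \<le> (a + D) * Q"
    by (intro mult_right_mono) fact+
  also have "\<dots> \<le> a * joint_acc u s w t + D * 1"
    unfolding distrib_right using assms Q1 \<open>0 \<le> D\<close> by (intro add_mono mult_left_mono) auto
  also have "a * joint_acc u s w t \<le> a * (joint_acc u a w a + D)"
    using J assms(4) by (intro mult_left_mono)
  finally have "c * Q \<le> a * joint_acc u a w a + (a + 1) * D"
    by (simp add: algebra_simps)
  then show ?thesis
    by (simp add: D_def)
qed

text \<open>Polarisation: r stands for h^2 ||Z_x - Z_y||^2, the only loss beyond the two of the
  upper bound. The profile is at most 1, so r costs at most r / 2.\<close>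

lemma accepted_product_ge:
  fixes a :: real
  assumes "2 * c = s + t - r" "0 \<le> r" "0 \<le> a"
  shows "a * joint_acc u a w a - (a + 1) / 2 * (\<bar>s - a\<bar> + \<bar>t - a\<bar>) - r / 2
    \<le> c * joint_acc u s w t"
proof -
  define D where "D = (\<bar>s - a\<bar> + \<bar>t - a\<bar>) / 2"
  let ?J = "joint_acc u s w t"
  have "a - D - r / 2 \<le> c" "0 \<le> D"
    using assms(1) unfolding D_def by argo+
  have J: "joint_acc u a w a - D \<le> ?J"
    using joint_acc_lipschitz[of u s w t a] unfolding D_def by linarith
  have "(a - D - r / 2) * ?J \<le> c * ?J"
    by (intro mult_right_mono joint_acc_bounds) fact
  moreover have "D * ?J \<le> D * 1" "r / 2 * ?J \<le> r / 2 * 1"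
    using assms joint_acc_bounds \<open>0 \<le> D\<close> by (intro mult_left_mono; auto)+
  moreover have "a * (joint_acc u a w a - D) \<le> a * ?J"
    using J assms(3) by (intro mult_left_mono)
  ultimately have "a * joint_acc u a w a - (a + 1) * D - r / 2 \<le> c * ?J"
    by (simp add: algebra_simps)
  then show ?thesis
    by (simp add: D_def)
qed

section \<open>Upper and lower bounds in finite dimension\<close>

lemma norm_sq_error:
  fixes l :: real
  assumes "0 < d"
  shows "integrable (Nd d) (\<lambda>z. \<bar>(l / sqrt (real d))\<^sup>2 * ip d z z - l\<^sup>2\<bar>)" (is "integrable _ ?f")
    and "(\<integral>z. \<bar>(l / sqrt (real d))\<^sup>2 * ip d z z - l\<^sup>2\<bar> \<partial>Nd d) \<le> l\<^sup>2 * sqrt 2 / sqrt (real d)"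
proof -
  interpret prob_space "Nd d" by simp
  show "integrable (Nd d) ?f"
    using integrable_Nd_norm_sq by auto
  have eq: "?f = (\<lambda>z. l\<^sup>2 / real d * \<bar>ip d z z - real d\<bar>)"
  proof
    fix z
    have "(l / sqrt (real d))\<^sup>2 * ip d z z - l\<^sup>2 = l\<^sup>2 / real d * (ip d z z - real d)"
      using assms by (simp add: power_divide field_simps)
    then show "?f z = l\<^sup>2 / real d * \<bar>ip d z z - real d\<bar>"
      by (simp add: abs_mult)
  qed
  have "(\<integral>z. ?f z \<partial>Nd d) = l\<^sup>2 / real d * (\<integral>z. \<bar>ip d z z - real d\<bar> \<partial>Nd d)"
    unfolding eq by (rule integral_mult_right_zero)
  also have "\<dots> \<le> l\<^sup>2 / real d * sqrt (2 * real d)"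
    by (intro mult_left_mono integral_Nd_norm_sq_deviation_le) auto
  also have "\<dots> = l\<^sup>2 * sqrt 2 / sqrt (real d)"
    using assms by (simp add: real_sqrt_mult field_simps)
  finally show "(\<integral>z. ?f z \<partial>Nd d) \<le> l\<^sup>2 * sqrt 2 / sqrt (real d)" .
qed

text \<open>The scaled projection is normal with standard deviation h ||X|| = (l / sqrt d) sqrt (d
  x) = l sqrt x, so its law is free of d.\<close>

lemma integral_Nd_scaled_ip:
  fixes p :: "real \<Rightarrow> real" and l x :: real
  assumes "0 < d" and X: "ip d X X = real d * x" and [measurable]: "p \<in> borel_measurable borel"
    and p: "\<And>u. \<bar>p u\<bar> \<le> 1"
  shows "integrable (Nd d) (\<lambda>z. p (l / sqrt (real d) * ip d X z))"
    and "(\<integral>z. p (l / sqrt (real d) * ip d X z) \<partial>Nd d) = (\<integral>z. p (l * sqrt x * z) \<partial>N1)"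
proof -
  interpret prob_space "Nd d" by simp
  have [measurable]: "ip d X \<in> measurable (Nd d) borel"
    by measurable
  show "integrable (Nd d) (\<lambda>z. p (l / sqrt (real d) * ip d X z))"
    using p by (intro integrable_const_bound[where B = 1]) auto
  have "(\<integral>z. p (l / sqrt (real d) * ip d X z) \<partial>Nd d)
      = (\<integral>u. p (l / sqrt (real d) * u) \<partial>distr (Nd d) borel (ip d X))"
    by (subst integral_distr) auto
  also have "\<dots> = (\<integral>z. p (l / sqrt (real d) * (sqrt (ip d X X) * z)) \<partial>N1)"
    unfolding distr_Nd_ip by (subst integral_distr) auto
  also have "\<dots> = (\<integral>z. p (l * sqrt x * z) \<partial>N1)"
    using assms by (simp add: real_sqrt_mult mult.assoc)
  finally show "(\<integral>z. p (l / sqrt (real d) * ip d X z) \<partial>Nd d) = (\<integral>z. p (l * sqrt x * z) \<partial>N1)" .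
qed

lemma rwm_cross_le:
  fixes l x y :: real
  assumes "0 < l" "0 \<le> x" "0 \<le> y" "0 < d"
    and X: "ip d X X = real d * x" and Y: "ip d Y Y = real d * y"
    and CU: "is_coupling unif01 CU" and CZ: "is_coupling (Nd d) CZ"
  shows "rwm_cross d (l / sqrt (real d)) X Y CU CZ
    \<le> l\<^sup>2 * (\<integral>z. joint_acc (l * sqrt x * z) (l\<^sup>2) (l * sqrt y * z) (l\<^sup>2) \<partial>N1)
      + (l\<^sup>2 + 1) * (l\<^sup>2 * sqrt 2 / sqrt (real d))"
proof -
  define h where "h = l / sqrt (real d)"
  interpret N1: prob_space N1 by simp
  obtain p q :: "real \<Rightarrow> real" where [measurable]: "p \<in> borel_measurable borel" "q \<in> borel_measurable borel"
    and p1: "\<And>u. \<bar>p u\<bar> \<le> 1" and q1: "\<And>w. \<bar>q w\<bar> \<le> 1"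
    and le: "\<And>u w. joint_acc u (l\<^sup>2) w (l\<^sup>2) \<le> p u + q w"
    and eq: "\<And>z. joint_acc (l * sqrt x * z) (l\<^sup>2) (l * sqrt y * z) (l\<^sup>2)
        = p (l * sqrt x * z) + q (l * sqrt y * z)"
    using joint_acc_potentials[of "l * sqrt x" "l * sqrt y" "l\<^sup>2"] assms by auto
  note fub = rwm_cross_fubini[OF CU CZ, where h = h and X = X and Y = Y]
  let ?D = "\<lambda>z. \<bar>h\<^sup>2 * ip d z z - l\<^sup>2\<bar>"
  let ?P = "\<lambda>z. p (h * ip d X z)" and ?Q = "\<lambda>z. q (h * ip d Y z)"
  let ?F = "\<lambda>z. h\<^sup>2 * ip d (fst z) (snd z) *
    measure CU ({..exp (- h * ip d X (fst z) - h\<^sup>2 * ip d (fst z) (fst z) / 2)} \<times>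
                {..exp (- h * ip d Y (snd z) - h\<^sup>2 * ip d (snd z) (snd z) / 2)})"
  \<comment> \<open>Every summand involves one proposal only, so the integral of \<open>?B\<close>
    is the same under every coupling \<open>CZ\<close>.\<close>
  let ?B = "\<lambda>z. l\<^sup>2 * (?P (fst z) + ?Q (snd z)) + (l\<^sup>2 + 1) / 2 * (?D (fst z) + ?D (snd z))"
  have bound: "?F z \<le> ?B z" for z
  proof -
    have "?F z \<le> l\<^sup>2 * joint_acc (h * ip d X (fst z)) (l\<^sup>2) (h * ip d Y (snd z)) (l\<^sup>2)
        + (l\<^sup>2 + 1) / 2 * (?D (fst z) + ?D (snd z))"
    proof (rule accepted_product_le)
      show "2 * \<bar>h\<^sup>2 * ip d (fst z) (snd z)\<bar> \<le> h\<^sup>2 * ip d (fst z) (fst z) + h\<^sup>2 * ip d (snd z) (snd z)"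
        using mult_left_mono[OF two_ip_le[of d "fst z" "snd z"], of "h\<^sup>2"]
        by (simp add: abs_mult algebra_simps)
      show "measure CU ({..exp (- h * ip d X (fst z) - h\<^sup>2 * ip d (fst z) (fst z) / 2)} \<times>
                {..exp (- h * ip d Y (snd z) - h\<^sup>2 * ip d (snd z) (snd z) / 2)})
        \<le> joint_acc (h * ip d X (fst z)) (h\<^sup>2 * ip d (fst z) (fst z))
            (h * ip d Y (snd z)) (h\<^sup>2 * ip d (snd z) (snd z))"
        unfolding joint_acc_def
        by (rule order_trans[OF coupling_unif01_rect_le[OF CU]]) auto
    qed simp_all
    also have "\<dots> \<le> ?B z"
      using le by (intro add_mono mult_left_mono) auto
    finally show ?thesis .
  qed
  note D = norm_sq_error[OF \<open>0 < d\<close>, of l, folded h_def]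
  note PI = integral_Nd_scaled_ip[OF \<open>0 < d\<close> X \<open>p \<in> borel_measurable borel\<close> p1, of l, folded h_def]
  note QI = integral_Nd_scaled_ip[OF \<open>0 < d\<close> Y \<open>q \<in> borel_measurable borel\<close> q1, of l, folded h_def]
  note marg = coupling_marginal[OF CZ D(1)] coupling_marginal[OF CZ PI(1)] coupling_marginal[OF CZ QI(1)]
  have "rwm_cross d h X Y CU CZ = (\<integral>z. ?F z \<partial>CZ)"
    by (rule fub(1))
  also have "\<dots> \<le> (\<integral>z. ?B z \<partial>CZ)"
    by (intro integral_mono fub(2) bound) (use marg in auto)
  also have "\<dots> = l\<^sup>2 * ((\<integral>z. ?P z \<partial>Nd d) + (\<integral>z. ?Q z \<partial>Nd d)) + (l\<^sup>2 + 1) * (\<integral>z. ?D z \<partial>Nd d)"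
    using marg by (simp add: algebra_simps)
  \<comment> \<open>The two marginal integrals are rewritten over one common normal variable. On
    that comonotone pair the potentials are tight, which restores the profile itself.\<close>
  also have "(\<integral>z. ?P z \<partial>Nd d) + (\<integral>z. ?Q z \<partial>Nd d) = (\<integral>z. p (l * sqrt x * z) + q (l * sqrt y * z) \<partial>N1)"
    unfolding PI(2) QI(2)
    by (intro Bochner_Integration.integral_add[symmetric] N1.integrable_const_bound[where B = 1])
       (auto simp: p1 q1)
  also have "\<dots> = (\<integral>z. joint_acc (l * sqrt x * z) (l\<^sup>2) (l * sqrt y * z) (l\<^sup>2) \<partial>N1)"
    by (simp only: eq)
  also have "l\<^sup>2 * \<dots> + (l\<^sup>2 + 1) * (\<integral>z. ?D z \<partial>Nd d)
      \<le> l\<^sup>2 * \<dots> + (l\<^sup>2 + 1) * (l\<^sup>2 * sqrt 2 / sqrt (real d))"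
    using D(2) by (intro add_left_mono mult_left_mono) auto
  finally show ?thesis
    unfolding h_def .
qed

text \<open>The common Z cancels in Z_x - Z_y, leaving one multiple of each direction; these
  directions have norm at most 1, so the bound does not grow with d. Applying (u - w)^2 <= 2 u^2 + 2
  w^2 twice gives the constants 8, 4, 4.\<close>

lemma gcrn_prop_diff:
  "ip d (gcrn_prop d X z z1) (gcrn_prop d X z z1) + ip d (gcrn_prop d Y z z1) (gcrn_prop d Y z z1)
      - 2 * ip d (gcrn_prop d X z z1) (gcrn_prop d Y z z1)
    \<in> {0..8 * z1\<^sup>2 + 4 * (ip d (gcrn_dir d X) z)\<^sup>2 + 4 * (ip d (gcrn_dir d Y) z)\<^sup>2}"
proof -
  let ?m = "gcrn_dir d X" and ?n = "gcrn_dir d Y"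
  let ?a = "z1 - ip d ?m z" and ?b = "z1 - ip d ?n z"
  have sq: "(u - w)\<^sup>2 \<le> 2 * u\<^sup>2 + 2 * w\<^sup>2" for u w :: real
    using zero_le_power2[of "u + w"] by (simp add: power2_eq_square algebra_simps)
  have "ip d (gcrn_prop d X z z1) (gcrn_prop d X z z1) + ip d (gcrn_prop d Y z z1) (gcrn_prop d Y z z1)
      - 2 * ip d (gcrn_prop d X z z1) (gcrn_prop d Y z z1)
    = (\<Sum>i<d. (gcrn_prop d X z z1 i - gcrn_prop d Y z z1 i)\<^sup>2)"
    by (simp add: ip_def power2_eq_square algebra_simps sum.distrib sum_subtractf sum_distrib_left)
  also have "\<dots> = (\<Sum>i<d. (?a * ?m i - ?b * ?n i)\<^sup>2)"
    unfolding gcrn_prop_alt by (intro sum.cong) auto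
  finally have eq: "ip d (gcrn_prop d X z z1) (gcrn_prop d X z z1) + ip d (gcrn_prop d Y z z1) (gcrn_prop d Y z z1)
      - 2 * ip d (gcrn_prop d X z z1) (gcrn_prop d Y z z1) = (\<Sum>i<d. (?a * ?m i - ?b * ?n i)\<^sup>2)" .
  have "(\<Sum>i<d. (?a * ?m i - ?b * ?n i)\<^sup>2) \<le> (\<Sum>i<d. 2 * ?a\<^sup>2 * (?m i * ?m i) + 2 * ?b\<^sup>2 * (?n i * ?n i))"
    by (intro sum_mono order_trans[OF sq]) (simp add: power2_eq_square mult_ac)
  also have "\<dots> = 2 * ?a\<^sup>2 * ip d ?m ?m + 2 * ?b\<^sup>2 * ip d ?n ?n"
    by (simp only: sum.distrib sum_distrib_left[symmetric] ip_def[of d ?m ?m] ip_def[of d ?n ?n])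
  also have "\<dots> \<le> 2 * ?a\<^sup>2 + 2 * ?b\<^sup>2"
    by (intro add_mono) (auto simp: ip_gcrn_dir_self)
  also have "\<dots> \<le> 8 * z1\<^sup>2 + 4 * (ip d ?m z)\<^sup>2 + 4 * (ip d ?n z)\<^sup>2"
    using sq[of z1 "ip d ?m z"] sq[of z1 "ip d ?n z"] by linarith
  finally show ?thesis
    unfolding eq by (simp add: sum_nonneg)
qed

lemma rwm_cross_gcrn_ge:
  fixes l x y :: real
  assumes "0 < l" "0 \<le> x" "0 \<le> y" "0 < d"
    and X: "ip d X X = real d * x" and Y: "ip d Y Y = real d * y"
  shows "l\<^sup>2 * (\<integral>z. joint_acc (l * sqrt x * z) (l\<^sup>2) (l * sqrt y * z) (l\<^sup>2) \<partial>N1)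
      - (l\<^sup>2 + 1) * (l\<^sup>2 * sqrt 2 / sqrt (real d)) - 8 * (l\<^sup>2 / real d)
    \<le> rwm_cross d (l / sqrt (real d)) X Y gcrn_U (gcrn_Z d X Y)"
proof -
  define h where "h = l / sqrt (real d)"
  interpret N1: prob_space N1 by simp
  interpret Nd: prob_space "Nd d" by simp
  interpret P: pair_prob_space "Nd d" N1 ..
  let ?P = "Nd d \<Otimes>\<^sub>M N1"
  let ?G = "\<lambda>W (z, z1). gcrn_prop d W z z1"
  let ?n = "\<lambda>W. ip d (gcrn_dir d W)"
  let ?D = "\<lambda>z. \<bar>h\<^sup>2 * ip d z z - l\<^sup>2\<bar>"
  \<comment> \<open>The minus signs come from the direction - X / ||X||; \<open>J_eq\<close> removes
    them by symmetry of the normal law.\<close>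
  let ?J = "\<lambda>z. joint_acc (- l * sqrt x * z) (l\<^sup>2) (- l * sqrt y * z) (l\<^sup>2)"
  have G [measurable]: "?G W \<in> measurable ?P (Nd d)" for W
    by measurable
  define F where "F = (\<lambda>z. h\<^sup>2 * ip d (fst z) (snd z) *
    joint_acc (h * ip d X (fst z)) (h\<^sup>2 * ip d (fst z) (fst z)) (h * ip d Y (snd z)) (h\<^sup>2 * ip d (snd z) (snd z)))"
  have F: "h\<^sup>2 * ip d (fst z) (snd z) *
    measure gcrn_U ({..exp (- h * ip d X (fst z) - h\<^sup>2 * ip d (fst z) (fst z) / 2)} \<times>
                {..exp (- h * ip d Y (snd z) - h\<^sup>2 * ip d (snd z) (snd z) / 2)}) = F z" for z
    by (simp add: F_def gcrn_U_rect joint_acc_def)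
  note fub = rwm_cross_fubini[OF is_coupling_gcrn_U is_coupling_gcrn_Z[of d X Y], where h = h and X = X and Y = Y,
      unfolded F]
  have pair [measurable]: "(\<lambda>(z, z1). (gcrn_prop d X z z1, gcrn_prop d Y z z1)) \<in> measurable ?P (Nd d \<Otimes>\<^sub>M Nd d)"
    by (simp add: case_prod_beta') measurable
  have [measurable]: "F \<in> borel_measurable (Nd d \<Otimes>\<^sub>M Nd d)"
    unfolding F_def by measurable
  have rwm: "rwm_cross d h X Y gcrn_U (gcrn_Z d X Y) = (\<integral>p. F (?G X p, ?G Y p) \<partial>?P)"
    unfolding fub(1) unfolding gcrn_Z_def by (subst integral_distr) (auto simp: case_prod_beta')
  have int: "integrable ?P (\<lambda>p. F (?G X p, ?G Y p))"
    using fub(2) unfolding gcrn_Z_def by (subst (asm) integrable_distr_eq) (auto simp: case_prod_beta')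
  let ?R = "\<lambda>p. 8 * (snd p)\<^sup>2 + 4 * (?n X (fst p))\<^sup>2 + 4 * (?n Y (fst p))\<^sup>2"
  let ?B = "\<lambda>p. l\<^sup>2 * ?J (snd p) - (l\<^sup>2 + 1) / 2 * (?D (?G X p) + ?D (?G Y p)) - h\<^sup>2 / 2 * ?R p"
  have scale: "h * ip d W (?G W p) = - l * sqrt w * snd p" if "ip d W W = real d * w" for W w p
    using that \<open>0 < d\<close> by (simp add: h_def case_prod_beta ip_gcrn_prop real_sqrt_mult)
  have bound: "?B p \<le> F (?G X p, ?G Y p)" for p
  proof -
    obtain z z1 where p: "p = (z, z1)" by (cases p)
    define zx zy where "zx = gcrn_prop d X z z1" and "zy = gcrn_prop d Y z z1"
    define r where "r = ip d zx zx + ip d zy zy - 2 * ip d zx zy"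
    have r: "0 \<le> r" "r \<le> ?R p"
      using gcrn_prop_diff[of d X z z1 Y] by (auto simp: r_def zx_def zy_def p)
    have uw: "h * ip d X zx = - l * sqrt x * z1" "h * ip d Y zy = - l * sqrt y * z1"
      using scale[OF X, of p] scale[OF Y, of p] by (simp_all add: p zx_def zy_def)
    have "2 * (h\<^sup>2 * ip d zx zy) = h\<^sup>2 * ip d zx zx + h\<^sup>2 * ip d zy zy - h\<^sup>2 * r" "0 \<le> h\<^sup>2 * r"
      using r(1) by (simp add: r_def algebra_simps) (use r(1) in simp)
    from accepted_product_ge[OF this, of "l\<^sup>2" "h * ip d X zx" "h * ip d Y zy"]
    have "l\<^sup>2 * ?J (snd p) - (l\<^sup>2 + 1) / 2 * (?D zx + ?D zy) - h\<^sup>2 * r / 2 \<le> F (zx, zy)"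
      unfolding F_def fst_conv snd_conv by (simp add: uw p)
    moreover have "h\<^sup>2 / 2 * r \<le> h\<^sup>2 / 2 * ?R p"
      using r by (intro mult_left_mono) auto
    ultimately show ?thesis
      by (simp add: p zx_def zy_def)
  qed
  note D = norm_sq_error[OF \<open>0 < d\<close>, of l, folded h_def]
  note DG = integrable_distr_eq_self[OF G distr_gcrn_prop D(1)]
  have J: "integrable N1 ?J"
    by (intro N1.integrable_const_bound[where B = 1]) (auto simp: joint_acc_bounds)
  note fst = integrable_distr_eq_self[OF measurable_fst distr_Nd_N1_fst]
    and snd = integrable_distr_eq_self[OF measurable_snd distr_Nd_N1_snd]
  note ints = DG[of X] DG[of Y] snd[OF J] snd[OF integrable_N1_sq]
    fst[OF integrable_Nd_ip_sq[of d "gcrn_dir d X"]] fst[OF integrable_Nd_ip_sq[of d "gcrn_dir d Y"]]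
  have J_eq: "(\<integral>z. ?J z \<partial>N1) = (\<integral>z. joint_acc (l * sqrt x * z) (l\<^sup>2) (l * sqrt y * z) (l\<^sup>2) \<partial>N1)"
  proof -
    have "(\<integral>z. ?J z \<partial>N1) = (\<integral>z. ?J z \<partial>distr N1 borel uminus)"
      by (simp only: distr_N1_uminus)
    also have "\<dots> = (\<integral>z. ?J (- z) \<partial>N1)"
      by (intro integral_distr) auto
    finally show ?thesis by simp
  qed
  have "(\<integral>p. ?B p \<partial>?P) = l\<^sup>2 * (\<integral>z. ?J z \<partial>N1) - (l\<^sup>2 + 1) * (\<integral>z. ?D z \<partial>Nd d)
      - h\<^sup>2 / 2 * (8 + 4 * ip d (gcrn_dir d X) (gcrn_dir d X) + 4 * ip d (gcrn_dir d Y) (gcrn_dir d Y))"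
    using ints by (simp add: integral_N1_sq integral_Nd_ip_sq algebra_simps)
  moreover have "(l\<^sup>2 + 1) * (\<integral>z. ?D z \<partial>Nd d) \<le> (l\<^sup>2 + 1) * (l\<^sup>2 * sqrt 2 / sqrt (real d))"
    using D(2) by (intro mult_left_mono) auto
  \<comment> \<open>E z1^2 = 1 and each projection of Z has second moment ||n||^2 <= 1, whence 8 + 4
    + 4 = 16 and, with h^2 = l^2 / d, the error 8 l^2 / d.\<close>
  moreover have "h\<^sup>2 / 2 * (8 + 4 * ip d (gcrn_dir d X) (gcrn_dir d X) + 4 * ip d (gcrn_dir d Y) (gcrn_dir d Y))
      \<le> h\<^sup>2 / 2 * 16"
    by (intro mult_left_mono) (auto simp: ip_gcrn_dir_self)
  moreover have "h\<^sup>2 / 2 * 16 = 8 * (l\<^sup>2 / real d)"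
    by (simp add: h_def power_divide)
  moreover have "(\<integral>p. ?B p \<partial>?P) \<le> (\<integral>p. F (?G X p, ?G Y p) \<partial>?P)"
    by (intro integral_mono int bound) (use ints in auto)
  ultimately show ?thesis
    unfolding h_def[symmetric] rwm J_eq by linarith
qed

section \<open>Passage to the limit\<close>

text \<open>Conditioning on the states amounts to fixing arbitrary sequences \<open>Xs\<close>,
  \<open>Ys\<close> with the prescribed inner products. These are prescribed only eventually: in
  dimension one they force |v| = sqrt (x y).\<close>

theorem theorem2:
  fixes l x y v :: real and Xs Ys :: "nat \<Rightarrow> nat \<Rightarrow> real"
  assumes "l > 0" and "x \<ge> 0" and "y \<ge> 0" and "\<bar>v\<bar> \<le> sqrt (x * y)"
    and "\<forall>\<^sub>F d in sequentially. ip d (Xs d) (Xs d) = real d * x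
            \<and> ip d (Ys d) (Ys d) = real d * y \<and> ip d (Xs d) (Ys d) = real d * v"
  shows "(\<lambda>d. SUP C\<in>product_couplings d.
              rwm_cross d (l / sqrt (real d)) (Xs d) (Ys d) (fst C) (snd C))
           \<longlonglongrightarrow> l\<^sup>2 * (\<integral>z. min 1 (min (exp (- l * sqrt x * z - l\<^sup>2 / 2))
                                          (exp (- l * sqrt y * z - l\<^sup>2 / 2))) \<partial>N1)
       \<and> (\<forall>d. (gcrn_U, gcrn_Z d (Xs d) (Ys d)) \<in> product_couplings d)
       \<and> (\<lambda>d. rwm_cross d (l / sqrt (real d)) (Xs d) (Ys d) gcrn_U (gcrn_Z d (Xs d) (Ys d)))
           \<longlonglongrightarrow> l\<^sup>2 * (\<integral>z. min 1 (min (exp (- l * sqrt x * z - l\<^sup>2 / 2))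
                                          (exp (- l * sqrt y * z - l\<^sup>2 / 2))) \<partial>N1)"
proof -
  define L where "L = l\<^sup>2 * (\<integral>z. joint_acc (l * sqrt x * z) (l\<^sup>2) (l * sqrt y * z) (l\<^sup>2) \<partial>N1)"
  have L: "l\<^sup>2 * (\<integral>z. min 1 (min (exp (- l * sqrt x * z - l\<^sup>2 / 2)) (exp (- l * sqrt y * z - l\<^sup>2 / 2))) \<partial>N1) = L"
    by (simp add: L_def joint_acc_def)
  define e where "e = (\<lambda>d::nat. (l\<^sup>2 + 1) * (l\<^sup>2 * sqrt 2 / sqrt (real d)))"
  define R where "R = (\<lambda>d C. rwm_cross d (l / sqrt (real d)) (Xs d) (Ys d) (fst C) (snd C))"
  define g where "g = (\<lambda>d. (gcrn_U, gcrn_Z d (Xs d) (Ys d)))"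
  have g: "g d \<in> product_couplings d" for d
    by (simp add: g_def product_couplings_def is_coupling_gcrn_U is_coupling_gcrn_Z)
  have lower_lim: "(\<lambda>d. L - e d - 8 * (l\<^sup>2 / real d)) \<longlonglongrightarrow> L" and upper_lim: "(\<lambda>d. L + e d) \<longlonglongrightarrow> L"
    unfolding e_def by real_asymp+
  have good: "\<forall>\<^sub>F d in sequentially. 0 < d \<and> ip d (Xs d) (Xs d) = real d * x \<and> ip d (Ys d) (Ys d) = real d * y"
    using assms(5) eventually_gt_at_top[of 0] by eventually_elim auto
  have upper: "R d C \<le> L + e d"
    if "0 < d \<and> ip d (Xs d) (Xs d) = real d * x \<and> ip d (Ys d) (Ys d) = real d * y" "C \<in> product_couplings d" for d C
    using rwm_cross_le[of l x y d "Xs d" "Ys d" "fst C" "snd C"] assms that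
    by (auto simp: R_def L_def e_def product_couplings_def)
  have lower: "L - e d - 8 * (l\<^sup>2 / real d) \<le> R d (g d)"
    if "0 < d \<and> ip d (Xs d) (Xs d) = real d * x \<and> ip d (Ys d) (Ys d) = real d * y" for d
    using rwm_cross_gcrn_ge[of l x y d "Xs d" "Ys d"] assms that
    by (simp add: R_def L_def e_def g_def)
  \<comment> \<open>A real supremum is meaningful only for a nonempty set bounded above; GCRN
    supplies the member and the bound uniform over couplings supplies the rest. Both the GCRN value
    and the supremum are then squeezed between the same two sequences.\<close>
  have sup: "R d (g d) \<le> (SUP C\<in>product_couplings d. R d C) \<and> (SUP C\<in>product_couplings d. R d C) \<le> L + e d"
    if "0 < d \<and> ip d (Xs d) (Xs d) = real d * x \<and> ip d (Ys d) (Ys d) = real d * y" for d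
    using upper[OF that] g[of d]
    by (intro conjI cSUP_upper cSUP_least bdd_aboveI2[where M = "L + e d"]) auto
  have "(\<lambda>d. R d (g d)) \<longlonglongrightarrow> L"
    by (rule tendsto_sandwich[OF _ _ lower_lim upper_lim]; use good in eventually_elim)
       (use lower upper g in auto)
  moreover have "(\<lambda>d. SUP C\<in>product_couplings d. R d C) \<longlonglongrightarrow> L"
    by (rule tendsto_sandwich[OF _ _ lower_lim upper_lim]; use good in eventually_elim)
       (use lower sup order_trans in blast)+
  ultimately show ?thesis
    unfolding L using g by (auto simp: R_def g_def)
qed

end
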